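(* Let $k\ge 3$, $\varepsilon>0$, and let $f:S_k\to[k]$ be a social choice function on one voter satisfying $\mathbf{D}(f,\mathrm{NONMANIP}(1,k))\ge\varepsilon$. Let $\sigma\in S_k$ be uniformly random. Then $$\mathbb{P}(\sigma\in M(f))\ \ge\ \mathbb{P}(\sigma\in M_3(f))\ \ge\ \frac{\varepsilon^3}{10^5\,k^{16}}.$$
   Context: $[k]=\{1,\dots,k\}$ is the set of alternatives, $S_k$ the set of total orderings of $[k]$, and a social choice function (SCF) on $n$ voters is a map $f:S_k^n\to[k]$ (here $n=1$). Write $a\overset{\sigma_i}{>}b$ if the ranking $\sigma_i$ ranks $a$ above $b$. $\sigma\in S_k^n$ is a manipulation point of $f$ if there are $i\in[n]$ and $\sigma'$ differing from $\sigma$ only in coordinate $i$ with $f(\sigma')\overset{\sigma_i}{>}f(\sigma)$; it is an $r$-manipulation point if such $\sigma'$ exists with $\sigma'_i$ obtained from $\sigma_i$ by permuting at most $r$ alternatives occupying adjacent positions of $\sigma_i$. $M(f)$, $M_r(f)$ denote these sets. For nonempty $H\subseteq[k]$, $\mathrm{top}_H$ maps a ranking to its highest-ranked element of $H$. A SCF taking exactly two values $a,b$ is monotone if whenever $\sigma,\sigma'$ differ only in coordinate $i$ with $f(\sigma)=a,f(\sigma')=b$, then $a\overset{\sigma_i}{>}b$ and $b\overset{\sigma'_i}{>}a$. $\mathrm{NONMANIP}(n,k)$ is the set of SCFs which either equal $\sigma\mapsto\mathrm{top}_H(\sigma_i)$ for some $i\in[n]$ and nonempty $H\subseteq[k]$,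 or are monotone and take exactly two values. $\mathbf{D}(f,g)=\mathbb{P}(f(\sigma)\neq g(\sigma))$ for uniform $\sigma$, and $\mathbf{D}(f,G)=\min_{g\in G}\mathbf{D}(f,g)$. *)

theory Defs
  imports "HOL-Probability.Probability" "HOL-Combinatorics.Multiset_Permutations"
begin

text \<open>A ranking of the alternatives \<open>{1..k}\<close> is the list of all of them, without repetition,
  most preferred first.\<close>

definition rankings :: "nat \<Rightarrow> nat list set" where
  "rankings k = permutations_of_set {1..k}"

definition prefers :: "nat list \<Rightarrow> nat \<Rightarrow> nat \<Rightarrow> bool" where
  "prefers s a b \<longleftrightarrow> (\<exists>i j. i < j \<and> j < length s \<and> s ! i = a \<and> s ! j = b)"

definition top_of :: "nat set \<Rightarrow> nat list \<Rightarrow> nat" where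
  "top_of H s = (THE a. a \<in> H \<and> (\<forall>b\<in>H - {a}. prefers s a b))"

text \<open>The voters are \<open>{1..n}\<close>. Profiles and social choice functions are extensional functions
  (\<open>undefined\<close> outside their domain), so that both sets are finite.\<close>

type_synonym profile = "nat \<Rightarrow> nat list"

definition profiles :: "nat \<Rightarrow> nat \<Rightarrow> profile set" where
  "profiles n k = {1..n} \<rightarrow>\<^sub>E rankings k"

definition scfs :: "nat \<Rightarrow> nat \<Rightarrow> (profile \<Rightarrow> nat) set" where
  "scfs n k = profiles n k \<rightarrow>\<^sub>E {1..k}"

definition differ_only_at :: "nat \<Rightarrow> nat \<Rightarrow> profile \<Rightarrow> profile \<Rightarrow> bool" where
  "differ_only_at n i \<sigma> \<sigma>' \<longleftrightarrow> (\<forall>j\<in>{1..n} - {i}. \<sigma>' j = \<sigma> j)"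

text \<open>\<open>t\<close> arises from \<open>s\<close> by permuting a block of at most \<open>r\<close> alternatives in consecutive
  positions.\<close>

definition block_permuted :: "nat \<Rightarrow> nat list \<Rightarrow> nat list \<Rightarrow> bool" where
  "block_permuted r s t \<longleftrightarrow> (\<exists>xs ys ys' zs.
     s = xs @ ys @ zs \<and> t = xs @ ys' @ zs \<and> mset ys' = mset ys \<and> length ys \<le> r)"

definition manipulation_points :: "nat \<Rightarrow> nat \<Rightarrow> (profile \<Rightarrow> nat) \<Rightarrow> profile set" where
  "manipulation_points n k f = {\<sigma> \<in> profiles n k. \<exists>i\<in>{1..n}. \<exists>\<sigma>'\<in>profiles n k.
     differ_only_at n i \<sigma> \<sigma>' \<and> prefers (\<sigma> i) (f \<sigma>') (f \<sigma>)}"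

definition r_manipulation_points :: "nat \<Rightarrow> nat \<Rightarrow> nat \<Rightarrow> (profile \<Rightarrow> nat) \<Rightarrow> profile set" where
  "r_manipulation_points r n k f = {\<sigma> \<in> profiles n k. \<exists>i\<in>{1..n}. \<exists>\<sigma>'\<in>profiles n k.
     differ_only_at n i \<sigma> \<sigma>' \<and> block_permuted r (\<sigma> i) (\<sigma>' i) \<and>
     prefers (\<sigma> i) (f \<sigma>') (f \<sigma>)}"

definition monotone_two_valued :: "nat \<Rightarrow> nat \<Rightarrow> (profile \<Rightarrow> nat) \<Rightarrow> bool" where
  "monotone_two_valued n k f \<longleftrightarrow> (\<exists>a b. a \<noteq> b \<and> f ` profiles n k = {a, b} \<and>
     (\<forall>i\<in>{1..n}. \<forall>\<sigma>\<in>profiles n k. \<forall>\<sigma>'\<in>profiles n k.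
        differ_only_at n i \<sigma> \<sigma>' \<and> f \<sigma> = a \<and> f \<sigma>' = b \<longrightarrow>
        prefers (\<sigma> i) a b \<and> prefers (\<sigma>' i) b a))"

definition NONMANIP :: "nat \<Rightarrow> nat \<Rightarrow> (profile \<Rightarrow> nat) set" where
  "NONMANIP n k = {g \<in> scfs n k.
     (\<exists>i\<in>{1..n}. \<exists>H. H \<noteq> {} \<and> H \<subseteq> {1..k} \<and> (\<forall>\<sigma>\<in>profiles n k. g \<sigma> = top_of H (\<sigma> i))) \<or>
     monotone_two_valued n k g}"

definition uniform_profile :: "nat \<Rightarrow> nat \<Rightarrow> profile pmf" where
  "uniform_profile n k = pmf_of_set (profiles n k)"

definition scf_dist :: "nat \<Rightarrow> nat \<Rightarrow> (profile \<Rightarrow> nat) \<Rightarrow> (profile \<Rightarrow> nat) \<Rightarrow> real" where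
  "scf_dist n k f g = measure_pmf.prob (uniform_profile n k) {\<sigma>. f \<sigma> \<noteq> g \<sigma>}"

definition scf_dist_set ::
    "nat \<Rightarrow> nat \<Rightarrow> (profile \<Rightarrow> nat) \<Rightarrow> (profile \<Rightarrow> nat) set \<Rightarrow> real" where
  "scf_dist_set n k f G = Min (scf_dist n k f ` G)"

end

theory Submission
  imports Defs
begin

text \<open>Only swaps of two adjacent alternatives are needed. Such a swap changes the value of
  \<open>F\<close> without a manipulation only if the value was the upper alternative of the pair and becomes
  the lower one. Fix an alternative \<open>b\<close>, and let \<open>b\<close> run through all positions of a ranking \<open>s\<close> of
  the others. If no manipulation point occurs, then \<open>F = b\<close> anywhere forces \<open>F (b # s) = b\<close>, whereas
  a value ranked below \<open>b\<close> persists when \<open>b\<close> moves to the top and forces \<open>F (b # s) \<noteq> b\<close>. Hence,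
  if both events are frequent, then \<open>{s. F (b # s) = b}\<close> and its complement are both large, so by an
  isoperimetric inequality many adjacent swaps lead out of it; each one yields a manipulation point,
  since \<open>b\<close> is on top. If on the other hand no \<open>b\<close> makes both events frequent, then \<open>F\<close> is close to
  \<open>top_of H\<close>, where \<open>H\<close> is the set of frequent values.\<close>

section \<open>Preferences and top elements in lists\<close>

lemma prefers_Nil [simp]: "\<not> prefers [] a b"
  by (simp add: prefers_def)

lemma prefers_Cons [simp]:
  "prefers (x # xs) a b \<longleftrightarrow> x = a \<and> b \<in> set xs \<or> prefers xs a b"
proof
  assume "prefers (x # xs) a b"
  then obtain i j where ij: "i < j" "j < Suc (length xs)" "(x # xs) ! i = a" "(x # xs) ! j = b"
    by (auto simp: prefers_def)
  then obtain j' where j': "j = Suc j'" by (cases j) auto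
  show "x = a \<and> b \<in> set xs \<or> prefers xs a b"
  proof (cases i)
    case 0
    then show ?thesis using ij j' by auto
  next
    case (Suc i')
    then show ?thesis using ij j' by (auto simp: prefers_def)
  qed
next
  assume "x = a \<and> b \<in> set xs \<or> prefers xs a b"
  then show "prefers (x # xs) a b"
  proof
    assume "x = a \<and> b \<in> set xs"
    then obtain j where "x = a" "j < length xs" "xs ! j = b" by (auto simp: in_set_conv_nth)
    then show ?thesis unfolding prefers_def by (intro exI[of _ 0] exI[of _ "Suc j"]) auto
  next
    assume "prefers xs a b"
    then obtain i j where "i < j" "j < length xs" "xs ! i = a" "xs ! j = b"
      by (auto simp: prefers_def)
    then show ?thesis unfolding prefers_def by (intro exI[of _ "Suc i"] exI[of _ "Suc j"]) auto
  qed
qed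

lemma prefers_append [simp]:
  "prefers (xs @ ys) a b \<longleftrightarrow>
     prefers xs a b \<or> prefers ys a b \<or> a \<in> set xs \<and> b \<in> set ys"
  by (induction xs) auto

lemma prefers_in_set: "prefers s a b \<Longrightarrow> a \<in> set s \<and> b \<in> set s"
  by (induction s) auto

lemma prefers_total:
  "a \<in> set s \<Longrightarrow> b \<in> set s \<Longrightarrow> a \<noteq> b \<Longrightarrow> prefers s a b \<or> prefers s b a"
  by (induction s) auto

lemma prefers_asym: "distinct s \<Longrightarrow> prefers s a b \<Longrightarrow> \<not> prefers s b a"
  by (induction s) (auto dest: prefers_in_set)

lemma top_of_eqI:
  assumes "distinct s" "a \<in> H" "\<And>b. b \<in> H \<Longrightarrow> b \<noteq> a \<Longrightarrow> prefers s a b"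
  shows "top_of H s = a"
  unfolding top_of_def using assms by (intro the_equality) (auto dest: prefers_asym)

lemma top_of_mem:
  assumes "distinct s" "H \<noteq> {}" "H \<subseteq> set s"
  shows "top_of H s \<in> H"
proof -
  obtain h where "h \<in> H" using assms by auto
  then have "\<exists>x\<in>set s. x \<in> H" using assms by auto
  \<comment> \<open>The first entry of \<open>s\<close> lying in \<open>H\<close> is its top
    element.\<close>
  then obtain us a vs where s: "s = us @ a # vs" "a \<in> H" "\<forall>x\<in>set us. x \<notin> H"
    by (auto dest!: split_list_first_prop)
  have "top_of H s = a"
    using assms s by (intro top_of_eqI) auto
  then show ?thesis using s by simp
qed

section \<open>Adjacent swaps without manipulation\<close>

definition local_manips :: "nat set \<Rightarrow> (nat list \<Rightarrow> nat) \<Rightarrow> nat list set" where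
  "local_manips X F = {s \<in> permutations_of_set X. \<exists>t\<in>permutations_of_set X.
     block_permuted 3 s t \<and> prefers s (F t) (F s)}"

lemma local_manipsI:
  assumes "us @ x # y # vs \<in> permutations_of_set X"
    and "prefers (us @ x # y # vs) (F (us @ y # x # vs)) (F (us @ x # y # vs))"
  shows "us @ x # y # vs \<in> local_manips X F"
proof -
  have "block_permuted 3 (us @ x # y # vs) (us @ y # x # vs)"
    unfolding block_permuted_def
    by (intro exI[of _ us] exI[of _ "[x, y]"] exI[of _ "[y, x]"] exI[of _ vs]) auto
  moreover have "us @ y # x # vs \<in> permutations_of_set X"
    using assms(1) by (auto simp: permutations_of_set_def)
  ultimately show ?thesis using assms unfolding local_manips_def by blast
qed

text \<open>The two rankings order every pair alike except \<open>x\<close> and \<open>y\<close>.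
  Absence of manipulation forces the first ranking to prefer its own value to the other one and
  forbids the second to do the same, so the values must be \<open>x\<close> and
  \<open>y\<close>.\<close>

lemma swap_not_manip:
  assumes F: "F ` permutations_of_set X \<subseteq> X"
    and s: "us @ x # y # vs \<in> permutations_of_set X"
    and ns: "us @ x # y # vs \<notin> local_manips X F"
    and nt: "us @ y # x # vs \<notin> local_manips X F"
    and ne: "F (us @ x # y # vs) \<noteq> F (us @ y # x # vs)"
  shows "F (us @ x # y # vs) = x"
proof -
  define s t where "s = us @ x # y # vs" and "t = us @ y # x # vs"
  have t: "t \<in> permutations_of_set X"
    using s by (auto simp: t_def permutations_of_set_def)
  have X: "set s = X" "set t = X" "distinct s" "distinct t"
    using s t by (auto simp: s_def permutations_of_set_def)
  have "\<not> prefers s (F t) (F s)" "\<not> prefers t (F s) (F t)"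
    using local_manipsI[of us x y vs X F] local_manipsI[of us y x vs X F] s t ns nt
    by (auto simp: s_def t_def)
  moreover have "F s \<in> X" "F t \<in> X"
    using F s t by (auto simp: s_def)
  ultimately have "prefers s (F s) (F t)" "\<not> prefers t (F s) (F t)"
    using prefers_total[of "F s" s "F t"] X ne by (auto simp: s_def t_def)
  then have "F s = x"
    unfolding s_def t_def by auto
  then show ?thesis by (simp add: s_def)
qed

text \<open>\<open>b\<close> climbs one place at a time. A swap with the \<open>x\<close> just above
  \<open>b\<close> could change the value only if it was \<open>x\<close>, but the value is
  \<open>b\<close> or ranked below \<open>b\<close>. This stays true after the swap, so the
  induction proceeds on the shorter prefix.\<close>

lemma move_to_top:
  assumes F: "F ` permutations_of_set X \<subseteq> X"
    and "us @ b # vs \<in> permutations_of_set X"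
    and "\<And>us' vs'. us' @ vs' = us @ vs \<Longrightarrow> us' @ b # vs' \<notin> local_manips X F"
    and "F (us @ b # vs) \<in> insert b (set vs)"
  shows "F (b # us @ vs) = F (us @ b # vs)"
  using assms(2-)
proof (induction us arbitrary: vs rule: rev_induct)
  case Nil
  then show ?case by simp
next
  case (snoc x us)
  have "F (us @ x # b # vs) = F (us @ b # x # vs)"
  proof (rule ccontr)
    assume "F (us @ x # b # vs) \<noteq> F (us @ b # x # vs)"
    then have "F (us @ x # b # vs) = x"
      using snoc.prems(1) snoc.prems(2)[of "us @ [x]" vs] snoc.prems(2)[of us "x # vs"]
      by (intro swap_not_manip[OF F]) auto
    then show False
      using snoc.prems(1,3) by (auto simp: permutations_of_set_def)
  qed
  moreover have "F (b # us @ x # vs) = F (us @ b # x # vs)"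
    using snoc.prems calculation
    by (intro snoc.IH) (auto simp: permutations_of_set_def)
  ultimately show ?case by simp
qed

section \<open>An isoperimetric inequality for adjacent transpositions\<close>

abbreviation adj_swap :: "nat \<Rightarrow> nat \<Rightarrow> nat" where
  "adj_swap i \<equiv> Transposition.transpose i (Suc i)"

text \<open>The part of the boundary of \<open>C\<close> crossed by \<open>p\<close>, which permutes
  positions and not entries.\<close>

definition exits :: "'a list set \<Rightarrow> (nat \<Rightarrow> nat) \<Rightarrow> 'a list set" where
  "exits C p = {s \<in> C. permute_list p s \<notin> C}"

lemma permute_list_in_permutations_of_set:
  assumes "p permutes {..<card X}" "s \<in> permutations_of_set X"
  shows "permute_list p s \<in> permutations_of_set X"
proof -
  have "length s = card X" using assms(2) by (rule length_finite_permutations_of_set)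
  then show ?thesis using assms by (auto simp: permutations_of_set_def)
qed

lemma inj_on_permute_list:
  assumes "p permutes {..<n}"
  shows "inj_on (permute_list p) {s. length s = n}"
proof (rule inj_on_inverseI)
  fix s :: "'a list" assume "s \<in> {s. length s = n}"
  then have "permute_list (inv p) (permute_list p s) = permute_list (p \<circ> inv p) s"
    using assms by (intro permute_list_compose[symmetric]) (auto intro: permutes_inv)
  then show "permute_list (inv p) (permute_list p s) = s"
    using permutes_inv_o[OF assms] by simp
qed

text \<open>A list carried out of \<open>C\<close> by \<open>p\<close> followed by \<open>q\<close>
  leaves either at the first step or at the second. Since \<open>permute_list p\<close> is injective
  on lists of the right length, those leaving at the second step embed into
  \<open>exits C q\<close>.\<close>

lemma card_exits_compose:
  fixes C :: "'a list set"
  assumes C: "C \<subseteq> permutations_of_set X"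
    and p: "p permutes {..<card X}" and q: "q permutes {..<card X}"
  shows "card (exits C (p \<circ> q)) \<le> card (exits C p) + card (exits C q)"
proof -
  have fin: "finite C" using finite_subset[OF C] by simp
  have len: "length s = card X" if "s \<in> C" for s
    using that C length_finite_permutations_of_set by auto
  define E where "E = {s \<in> C. permute_list p s \<in> exits C q}"
  have "exits C (p \<circ> q) \<subseteq> exits C p \<union> E"
    using len q by (auto simp: exits_def E_def permute_list_compose)
  then have "card (exits C (p \<circ> q)) \<le> card (exits C p \<union> E)"
    using fin by (intro card_mono) (auto simp: exits_def E_def)
  also have "\<dots> \<le> card (exits C p) + card E" by (rule card_Un_le)
  also have "card E \<le> card (exits C q)"
    using fin len
    by (intro card_inj_on_le[where f = "permute_list p"] inj_on_subset[OF inj_on_permute_list[OF p]])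
      (auto simp: E_def exits_def)
  finally show ?thesis by simp
qed

text \<open>Sorting by adjacent swaps: bring \<open>p n\<close> up to \<open>n\<close>, then recurse
  on \<open>{..<n}\<close>. Each swap costs at most \<open>B\<close> by
  \<open>card_exits_compose\<close>.\<close>

lemma card_exits_le:
  fixes C :: "'a list set"
  assumes C: "C \<subseteq> permutations_of_set X"
    and B: "\<And>i. Suc i < card X \<Longrightarrow> card (exits C (adj_swap i)) \<le> B"
  shows "n \<le> card X \<Longrightarrow> p permutes {..<n} \<Longrightarrow> card (exits C p) \<le> n\<^sup>2 * B"
proof (induction n arbitrary: p)
  case 0
  then show ?case by (simp add: exits_def)
next
  case (Suc n)
  \<comment> \<open>\<open>d\<close> is the distance from \<open>p n\<close> to \<open>n\<close>.
    Composing with \<open>adj_swap (p n)\<close> on the left lowers it by one, and at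
    \<open>d = 0\<close> the point \<open>n\<close> is fixed.\<close>
  have step: "card (exits C p) \<le> (n\<^sup>2 + d) * B" if "p permutes {..<Suc n}" "p n + d = n" for p d
    using that
  proof (induction d arbitrary: p)
    case 0
    have "p permutes {..<n}"
      by (rule permutes_superset[OF "0.prems"(1)]) (use "0.prems"(2) in \<open>auto simp: less_Suc_eq\<close>)
    then show ?case using Suc.IH Suc.prems by simp
  next
    case (Suc d)
    define j where "j = p n"
    have j: "Suc j < Suc n" using Suc.prems by (simp add: j_def)
    have tr: "adj_swap j permutes {..<Suc n}"
      using j by (intro permutes_swap_id) auto
    define q where "q = adj_swap j \<circ> p"
    have q: "q permutes {..<Suc n}" unfolding q_def using Suc.prems tr by (intro permutes_compose)
    have pq: "p = adj_swap j \<circ> q" by (auto simp: q_def fun_eq_iff)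
    have "card (exits C q) \<le> (n\<^sup>2 + d) * B"
    proof (rule Suc.IH[OF q])
      have "q n = Suc j" by (simp add: q_def flip: j_def)
      then show "q n + d = n" using Suc.prems(2) by (simp add: j_def)
    qed
    moreover have "card (exits C p) \<le> card (exits C (adj_swap j)) + card (exits C q)"
      unfolding pq using \<open>Suc n \<le> card X\<close>
      by (intro card_exits_compose[OF C] permutes_subset[OF tr] permutes_subset[OF q]) auto
    moreover have "card (exits C (adj_swap j)) \<le> B"
      using j \<open>Suc n \<le> card X\<close> by (intro B) auto
    ultimately show ?case by (simp add: algebra_simps)
  qed
  have "p n \<le> n"
    using permutes_in_image[OF Suc.prems(2), of n] by simp
  then have "card (exits C p) \<le> (n\<^sup>2 + (n - p n)) * B"
    by (intro step Suc.prems(2)) simp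
  \<comment> \<open>At most \<open>n\<close> swaps are added, and n^2 + n \<le> (n + 1)^2.\<close>
  also have "\<dots> \<le> (Suc n)\<^sup>2 * B"
    by (intro mult_right_mono) (auto simp: power2_eq_square)
  finally show ?case .
qed

text \<open>Averaging over the regular action: every pair in \<open>C \<times> (permutations_of_set X - C)\<close> is joined
  by a position permutation, and each of these is a word in at most \<open>(card X)\<^sup>2\<close> adjacent
  transpositions.\<close>

lemma card_mult_complement_le:
  fixes C :: "'a list set"
  assumes C: "C \<subseteq> permutations_of_set X"
    and B: "\<And>i. Suc i < card X \<Longrightarrow> card (exits C (adj_swap i)) \<le> B"
  shows "card C * card (permutations_of_set X - C) \<le> fact (card X) * ((card X)\<^sup>2 * B)"
proof -
  define P where "P = {p. p permutes {..<card X}}"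
  have fin: "finite C" using finite_subset[OF C] by simp
  have finP: "finite P" by (simp add: P_def finite_permutations)
  have finS: "finite (SIGMA p : P. exits C p)"
    using fin finP by (auto simp: exits_def)
  have "C \<times> (permutations_of_set X - C) \<subseteq>
      (\<lambda>(p, s). (s, permute_list p s)) ` (SIGMA p : P. exits C p)"
  proof clarify
    fix s t assume st: "s \<in> C" "t \<in> permutations_of_set X" "t \<notin> C"
    then have s: "s \<in> permutations_of_set X" using C by auto
    then have "mset t = mset s"
      using st by (metis mset_set_set permutations_of_setD)
    then obtain p where "p permutes {..<length s}" "permute_list p s = t"
      by (rule mset_eq_permutation)
    then show "(s, t) \<in> (\<lambda>(p, s). (s, permute_list p s)) ` (SIGMA p : P. exits C p)"
      using st s length_finite_permutations_of_set[OF s]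
      by (intro image_eqI[of _ _ "(p, s)"]) (auto simp: P_def exits_def)
  qed
  then have "card (C \<times> (permutations_of_set X - C)) \<le> card (SIGMA p : P. exits C p)"
    using finS by (rule surj_card_le[rotated])
  also have "\<dots> = (\<Sum>p\<in>P. card (exits C p))"
    using finP fin by (intro card_SigmaI) (auto simp: exits_def)
  also have "\<dots> \<le> (\<Sum>p\<in>P. (card X)\<^sup>2 * B)"
    using card_exits_le[OF assms] by (intro sum_mono) (auto simp: P_def)
  also have "\<dots> = fact (card X) * ((card X)\<^sup>2 * B)"
    by (simp add: P_def card_permutations[of _ "card X"])
  finally show ?thesis by (simp add: card_cartesian_product)
qed

section \<open>Counting around a single alternative\<close>

lemma permute_list_adjacent_transpose:
  "permute_list (adj_swap (length us)) (us @ x # y # vs) = us @ y # x # vs"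
proof (rule nth_equalityI)
  fix i assume i: "i < length (permute_list (adj_swap (length us)) (us @ x # y # vs))"
  then have *: "permute_list (adj_swap (length us)) (us @ x # y # vs) ! i =
      (us @ x # y # vs) ! adj_swap (length us) i"
    by (simp add: permute_list_def del: upt_Suc)
  have "i < length us \<or> i = length us \<or> i = Suc (length us) \<or> (\<exists>j. i = length us + Suc (Suc j))"
    by presburger
  then show "permute_list (adj_swap (length us)) (us @ x # y # vs) ! i = (us @ y # x # vs) ! i"
    unfolding * by (elim disjE exE) (simp_all add: Transposition.transpose_def nth_append)
qed simp

text \<open>Deleting \<open>b\<close> is at most \<open>card X\<close>-to-one: the remainder and the
  position of \<open>b\<close> determine the ranking.\<close>

lemma card_fiber_le:
  assumes "finite A" "A \<subseteq> permutations_of_set (X - {b})"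
    and T: "T \<subseteq> permutations_of_set X"
    and "finite X" "b \<in> X"
    and rem: "\<And>us vs. us @ b # vs \<in> T \<Longrightarrow> us @ vs \<in> A"
  shows "card T \<le> card X * card A"
proof -
  have "T \<subseteq> (\<lambda>(p, s). take p s @ b # drop p s) ` ({..<card X} \<times> A)"
  proof
    fix s assume s: "s \<in> T"
    then have sX: "s \<in> permutations_of_set X" using T by auto
    then have "b \<in> set s" using assms by (auto simp: permutations_of_set_def)
    then obtain us vs where us: "s = us @ b # vs" by (meson split_list)
    then have "length us < card X" "us @ vs \<in> A"
      using s rem length_finite_permutations_of_set[OF sX] by auto
    then show "s \<in> (\<lambda>(p, s). take p s @ b # drop p s) ` ({..<card X} \<times> A)"
      unfolding us by (intro image_eqI[of _ _ "(length us, us @ vs)"]) auto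
  qed
  then have "card T \<le> card ({..<card X} \<times> A)"
    using assms(1) by (intro surj_card_le) auto
  then show ?thesis by (simp add: card_cartesian_product)
qed

text \<open>\<open>c\<close> and \<open>c'\<close> are the sizes of \<open>C\<close> and of its
  complement in \<open>R\<close>: the rankings of the other alternatives for which the value is,
  respectively is not, \<open>b\<close> once \<open>b\<close> is put on top. The factor
  \<open>k\<close> counts the positions of \<open>b\<close>, and \<open>card M\<close> allows for
  remainders with a manipulation point in their fibre.\<close>

lemma manip_bound:
  fixes F :: "nat list \<Rightarrow> nat"
  assumes F: "F ` permutations_of_set X \<subseteq> X" and X: "finite X" and b: "b \<in> X"
  defines "k \<equiv> card X" and "M \<equiv> local_manips X F"
  defines "A \<equiv> {s \<in> permutations_of_set X. F s = b}"
    and "A' \<equiv> {s \<in> permutations_of_set X. prefers s b (F s)}"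
  shows "\<exists>c c'. card A \<le> k * (c + card M) \<and> card A' \<le> k * (c' + card M) \<and>
    c * c' \<le> fact (k - 1) * (k\<^sup>2 * card M)"
proof -
  define R where "R = permutations_of_set (X - {b})"
  define C where "C = {s \<in> R. F (b # s) = b}"
  \<comment> \<open>The remainders into which \<open>b\<close> can be inserted so as to give a
    manipulation point; outside \<open>D\<close>, \<open>move_to_top\<close> applies.\<close>
  define D where "D = {s \<in> R. \<exists>us vs. s = us @ vs \<and> us @ b # vs \<in> M}"
  have fin: "finite R" "finite C" "finite D" "finite M"
    by (auto simp: R_def C_def D_def M_def local_manips_def)
  have MX: "M \<subseteq> permutations_of_set X" by (auto simp: M_def local_manips_def)
  have remR: "us @ vs \<in> R" if "us @ b # vs \<in> permutations_of_set X" for us vs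
    using that by (auto simp: R_def permutations_of_set_def)
  have "D \<subseteq> remove1 b ` M"
  proof
    fix s assume "s \<in> D"
    then obtain us vs where s: "s = us @ vs" "us @ b # vs \<in> M" by (auto simp: D_def)
    then have "b \<notin> set us" using MX by (auto simp: permutations_of_set_def)
    then show "s \<in> remove1 b ` M"
      using s by (intro image_eqI[of _ _ "us @ b # vs"]) (auto simp: remove1_append)
  qed
  then have D: "card D \<le> card M" using fin by (intro surj_card_le)
  have top: "F (b # us @ vs) = F (us @ b # vs)"
    if "us @ b # vs \<in> permutations_of_set X" "us @ vs \<notin> D" "F (us @ b # vs) \<in> insert b (set vs)"
    for us vs
  proof (rule move_to_top[OF F that(1) _ that(3)])
    fix us' vs' assume eq: "us' @ vs' = us @ vs"
    show "us' @ b # vs' \<notin> local_manips X F"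
    proof
      assume "us' @ b # vs' \<in> local_manips X F"
      then have "us @ vs \<in> D"
        unfolding D_def M_def
        by (intro CollectI conjI remR[OF that(1)] exI[of _ us'] exI[of _ vs']) (simp_all add: eq)
      then show False using that(2) by simp
    qed
  qed
  have "card A \<le> k * card (C \<union> D)"
    unfolding k_def
  proof (rule card_fiber_le[OF _ _ _ X b])
    show "us @ vs \<in> C \<union> D" if "us @ b # vs \<in> A" for us vs
      using that top[of us vs] remR[of us vs] by (auto simp: A_def C_def)
  qed (use fin in \<open>auto simp: A_def C_def D_def R_def\<close>)
  also have "\<dots> \<le> k * (card C + card M)"
    using card_Un_le[of C D] D by (intro mult_left_mono) auto
  finally have 1: "card A \<le> k * (card C + card M)" .
  have "card A' \<le> k * card ((R - C) \<union> D)"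
    unfolding k_def
  proof (rule card_fiber_le[OF _ _ _ X b])
    \<comment> \<open>The value is strictly below \<open>b\<close>. Off \<open>D\<close> it survives
      moving \<open>b\<close> to the top, so it is still not \<open>b\<close> and the remainder
      misses \<open>C\<close>.\<close>
    show "us @ vs \<in> (R - C) \<union> D" if s: "us @ b # vs \<in> A'" for us vs
    proof -
      have "distinct (us @ b # vs)" "prefers (us @ b # vs) b (F (us @ b # vs))"
        "us @ b # vs \<in> permutations_of_set X"
        using s by (auto simp: A'_def permutations_of_set_def)
      then have "F (us @ b # vs) \<in> set vs" "F (us @ b # vs) \<noteq> b"
        by (auto dest: prefers_in_set)
      then show ?thesis
        using s top[of us vs] remR[of us vs] by (cases "us @ vs \<in> D") (auto simp: A'_def C_def)
    qed
  qed (use fin in \<open>auto simp: A'_def C_def D_def R_def\<close>)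
  also have "\<dots> \<le> k * (card (R - C) + card M)"
    using card_Un_le[of "R - C" D] D by (intro mult_left_mono) auto
  finally have 2: "card A' \<le> k * (card (R - C) + card M)" .
  have cX: "card (X - {b}) = k - 1" using X b by (simp add: k_def)
  \<comment> \<open>With \<open>b\<close> on top, a swap leading out of \<open>C\<close> loses the
    value \<open>b\<close>, and swapping back regains this favourite. The ranking reached is thus a
    manipulation point, and distinct exits reach distinct ones.\<close>
  have "card (exits C (adj_swap i)) \<le> card M" if i: "Suc i < card (X - {b})" for i
  proof (rule card_inj_on_le)
    let ?t = "permute_list (adj_swap i)"
    have "adj_swap i permutes {..<card (X - {b})}"
      using i by (intro permutes_swap_id) auto
    then have "inj_on ?t (exits C (adj_swap i))"
      by (rule inj_on_subset[OF inj_on_permute_list])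
        (auto simp: exits_def C_def R_def dest: length_finite_permutations_of_set)
    then show "inj_on (\<lambda>s. b # ?t s) (exits C (adj_swap i))"
      by (auto simp: inj_on_def)
    show "(\<lambda>s. b # ?t s) ` exits C (adj_swap i) \<subseteq> M"
    proof clarify
      fix s assume "s \<in> exits C (adj_swap i)"
      then have s: "s \<in> R" "F (b # s) = b" "?t s \<notin> C"
        by (auto simp: exits_def C_def)
      then have "length s = card (X - {b})"
        by (auto simp: R_def length_finite_permutations_of_set)
      then have "s = take i s @ s ! i # s ! Suc i # drop (Suc (Suc i)) s" "length (take i s) = i"
        using i by (auto simp: Cons_nth_drop_Suc)
      then obtain us x y vs where s': "s = us @ x # y # vs" "length us = i" by blast
      then have t: "?t s = us @ y # x # vs"
        using permute_list_adjacent_transpose[of us x y vs] by simp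
      have X: "b # us @ y # x # vs \<in> permutations_of_set X"
        using s(1) s' b by (auto simp: R_def permutations_of_set_def)
      then have "F (b # us @ y # x # vs) \<noteq> b"
        using s(3) t remR[of "[]" "us @ y # x # vs"] by (auto simp: C_def)
      moreover have "F (b # us @ y # x # vs) \<in> X"
        using F X by blast
      ultimately have "F (b # us @ y # x # vs) \<in> set (us @ y # x # vs)"
        using X by (auto simp: permutations_of_set_def)
      then have "b # us @ y # x # vs \<in> M"
        using local_manipsI[of "b # us" y x vs X F] X s(2) s'(1) by (auto simp: M_def)
      then show "b # ?t s \<in> M" by (simp only: t)
    qed
  qed (use fin in auto)
  then have "card C * card (R - C) \<le> fact (k - 1) * ((k - 1)\<^sup>2 * card M)"
    using card_mult_complement_le[of C "X - {b}" "card M"] cX by (auto simp: C_def R_def)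
  also have "\<dots> \<le> fact (k - 1) * (k\<^sup>2 * card M)"
    by (intro mult_left_mono mult_right_mono power_mono) auto
  finally show ?thesis using 1 2 by blast
qed


section \<open>From distance to many manipulation points\<close>

lemma local_manips_lower_bound:
  fixes F :: "nat list \<Rightarrow> nat" and e :: real
  assumes F: "F ` permutations_of_set X \<subseteq> X" and X: "finite X" "X \<noteq> {}"
    and e: "0 < e" "e \<le> 1"
    and far: "\<And>H. H \<noteq> {} \<Longrightarrow> H \<subseteq> X \<Longrightarrow>
      e * fact (card X) \<le> card {s \<in> permutations_of_set X. F s \<noteq> top_of H s}"
  shows "e\<^sup>2 / (4 * real (card X) ^ 5) * fact (card X) \<le> card (local_manips X F)"
proof -
  define k where "k = card X"
  define S where "S = permutations_of_set X"
  define M where "M = real (card (local_manips X F))"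
  define N :: real where "N = fact k"
  define A where "A b = {s \<in> S. F s = b}" for b
  define A' where "A' b = {s \<in> S. prefers s b (F s)}" for b
  \<comment> \<open>The threshold \<open>e * N / k\<close> is the average share per alternative of a
    set of \<open>e * N\<close> rankings, as the pigeonhole argument requires.\<close>
  define H where "H = {a \<in> X. e * N / k \<le> card (A a)}"
  have k: "k > 0" using X by (auto simp: k_def)
  have N: "N > 0" by (simp add: N_def)
  have fin: "finite S" "finite (A b)" "finite (A' b)" for b by (auto simp: S_def A_def A'_def)
  have pigeonhole: "\<exists>a\<in>X. e * N / k \<le> card (T a)"
    if "U \<subseteq> (\<Union>a\<in>X. T a)" "e * N \<le> card U" "\<And>a. finite (T a)" for U :: "nat list set" and T
  proof (rule ccontr)
    assume "\<not> ?thesis"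
    then have "(\<Sum>a\<in>X. real (card (T a))) < (\<Sum>a\<in>X. e * N / k)"
      using X by (intro sum_strict_mono) auto
    also have "\<dots> = e * N" using k by (simp add: k_def)
    also have "\<dots> \<le> card (\<Union>a\<in>X. T a)"
      using that X card_mono[OF _ that(1)] by (auto intro: order_trans)
    also have "\<dots> \<le> (\<Sum>a\<in>X. real (card (T a)))"
      using card_UN_le[OF X(1), of T] by (metis of_nat_le_iff of_nat_sum)
    finally show False by simp
  qed
  have "card S = N" using X by (simp add: S_def N_def k_def)
  then have "\<exists>a\<in>X. e * N / k \<le> card (A a)"
    using F e N fin by (intro pigeonhole[of S]) (auto simp: A_def S_def)
  then have H: "H \<noteq> {}" "H \<subseteq> X" by (auto simp: H_def)
  \<comment> \<open>A ranking on which \<open>F\<close> and \<open>top_of H\<close> disagree either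
    has its value outside \<open>H\<close> or ranks some \<open>b\<close> in \<open>H\<close> above
    its value.\<close>
  have "\<exists>a\<in>X. e * N / k \<le> card (if a \<in> H then A' a else A a)"
  proof (rule pigeonhole)
    show "{s \<in> S. F s \<noteq> top_of H s} \<subseteq> (\<Union>a\<in>X. if a \<in> H then A' a else A a)"
    proof clarify
      fix s assume s: "s \<in> S" "F s \<noteq> top_of H s"
      have FX: "F s \<in> X" using F s by (auto simp: S_def)
      show "s \<in> (\<Union>a\<in>X. if a \<in> H then A' a else A a)"
      proof (cases "F s \<in> H")
        case False
        then show ?thesis using s FX by (intro UN_I[of "F s"]) (auto simp: A_def)
      next
        case True
        have ds: "distinct s" "set s = X" using s by (auto simp: S_def permutations_of_set_def)
        obtain b where b: "b \<in> H" "b \<noteq> F s" "\<not> prefers s (F s) b"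
          using top_of_eqI[OF ds(1) True] s(2) by metis
        then have "prefers s b (F s)"
          using prefers_total[of "F s" s b] ds FX H by auto
        then show ?thesis using s b H by (intro UN_I[of b]) (auto simp: A'_def)
      qed
    qed
    show "e * N \<le> card {s \<in> S. F s \<noteq> top_of H s}"
      using far[OF H] by (simp add: N_def k_def S_def)
  qed (use fin in auto)
  \<comment> \<open>The alternative found lies in \<open>H\<close>, since outside \<open>H\<close>
    the set \<open>A a\<close> is below the threshold. So both \<open>A b\<close> and
    \<open>A' b\<close> are large.\<close>
  then obtain b where b: "b \<in> H" "e * N / k \<le> card (A' b)"
    by (auto simp: H_def split: if_splits)
  then have b': "b \<in> X" "e * N / k \<le> card (A b)" by (auto simp: H_def)
  obtain c c' where c: "card (A b) \<le> k * (c + card (local_manips X F))"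
    "card (A' b) \<le> k * (c' + card (local_manips X F))"
    "c * c' \<le> fact (k - 1) * (k\<^sup>2 * card (local_manips X F))"
    using manip_bound[OF F X(1) b'(1)] unfolding A_def A'_def S_def k_def by blast
  have fact: "real (fact (k - 1)) = N / k"
    using k by (cases k) (auto simp: N_def)
  have cs: "e * N / k \<le> k * (c + M)" "e * N / k \<le> k * (c' + M)"
    using b(2) b'(2) of_nat_mono[OF c(1), where 'a = real] of_nat_mono[OF c(2), where 'a = real]
    by (auto simp: M_def)
  have cc: "real c * real c' \<le> N * k * M"
    using of_nat_mono[OF c(3), where 'a = real] fact k by (simp add: M_def power2_eq_square)
  \<comment> \<open>Chosen so that \<open>k * (t + t) = e * N / k\<close>. If \<open>M < t\<close>,
    then \<open>c\<close> and \<open>c'\<close> are both at least \<open>t\<close>, and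
    \<open>cc\<close> becomes a lower bound on \<open>M\<close>.\<close>
  define t where "t = e * N / (2 * k\<^sup>2)"
  have "e\<^sup>2 / (4 * real k ^ 5) * N \<le> M"
  proof (cases "t \<le> M")
    case True
    \<comment> \<open>The bound \<open>t\<close> is linear in \<open>e\<close>, hence the stronger
      one because \<open>e \<le> 1\<close>.\<close>
    have "e\<^sup>2 / (4 * real k ^ 5) * N \<le> t"
    proof -
      have "e * e \<le> e * 1" using e by (intro mult_left_mono) auto
      moreover have "2 * real k ^ 2 \<le> 4 * real k ^ 5" using k by (intro mult_mono power_increasing) auto
      ultimately have "e\<^sup>2 / (4 * real k ^ 5) \<le> e / (2 * (real k)\<^sup>2)"
        using e k by (intro frac_le) (auto simp: power2_eq_square)
      from mult_right_mono[OF this, of N] N show ?thesis by (simp add: t_def)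
    qed
    then show ?thesis using True by simp
  next
    case False
    have "k * (t + M) \<le> k * (t + t)"
      using False by (intro mult_left_mono) auto
    also have "\<dots> = e * N / k"
      using k by (simp add: t_def power2_eq_square)
    finally have "k * (t + M) \<le> e * N / k" .
    then have "k * (t + M) \<le> k * (c + M)"
      "k * (t + M) \<le> k * (c' + M)"
      using cs by linarith+
    then have "t \<le> c" "t \<le> c'"
      using k by (simp_all only: mult_le_cancel_left_pos of_nat_0_less_iff add_le_cancel_right)
    then have "t * t \<le> real c * real c'"
      using e N by (intro mult_mono) (auto simp: t_def)
    also note cc
    finally have "t * t \<le> N * k * M" .
    \<comment> \<open>Here t^2 = e^2 N^2 / (4 k^4); dividing by \<open>N * k\<close> will leave e^2
      N / (4 k^5).\<close>
    then have "N * (e\<^sup>2 * N) \<le> N * (M * (4 * real k ^ 5))"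
      using k by (simp add: t_def field_simps power2_eq_square eval_nat_numeral)
    then have "e\<^sup>2 * N \<le> M * (4 * real k ^ 5)"
      using N by simp
    then show ?thesis using k by (simp add: field_simps)
  qed
  then show ?thesis by (simp add: M_def N_def k_def)
qed

section \<open>Rankings as profiles of one voter\<close>

definition lone_voter :: "nat list \<Rightarrow> profile" where
  "lone_voter s = (\<lambda>i\<in>{1..1}. s)"

lemma lone_voter_1 [simp]: "lone_voter s 1 = s" "lone_voter s (Suc 0) = s"
  by (simp_all add: lone_voter_def)

lemma inj_lone_voter: "inj_on lone_voter A"
  by (metis inj_onI lone_voter_1(1))

text \<open>A profile is extensional, hence determined by its value at \<open>1\<close>. The second
  form serves the simplifier, which rewrites \<open>1\<close> to \<open>Suc 0\<close>.\<close>

lemma profiles_1: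
  "profiles 1 k = lone_voter ` rankings k" "profiles (Suc 0) k = lone_voter ` rankings k"
proof -
  have "profiles 1 k \<subseteq> lone_voter ` rankings k"
  proof
    fix \<sigma> assume \<sigma>: "\<sigma> \<in> profiles 1 k"
    then have "\<sigma> = lone_voter (\<sigma> 1)"
      by (auto simp: profiles_def lone_voter_def PiE_def extensional_def)
    then show "\<sigma> \<in> lone_voter ` rankings k"
      using \<sigma> by (auto simp: profiles_def)
  qed
  moreover have "lone_voter ` rankings k \<subseteq> profiles 1 k"
    by (auto simp: profiles_def lone_voter_def PiE_def extensional_def)
  ultimately show "profiles 1 k = lone_voter ` rankings k" by blast
  then show "profiles (Suc 0) k = lone_voter ` rankings k" by simp
qed

lemma rankings_facts:
  "finite (rankings k)" "rankings k \<noteq> {}" "card (rankings k) = fact k"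
  by (simp_all add: rankings_def)

lemma prob_uniform_profile_1:
  "measure_pmf.prob (uniform_profile 1 k) {\<sigma> \<in> profiles 1 k. Q \<sigma>} =
     card {s \<in> rankings k. Q (lone_voter s)} / fact k"
proof -
  have "profiles 1 k \<inter> {\<sigma> \<in> profiles 1 k. Q \<sigma>} = lone_voter ` {s \<in> rankings k. Q (lone_voter s)}"
    by (auto simp: profiles_1)
  then show ?thesis
    unfolding uniform_profile_def
    by (subst measure_pmf_of_set)
      (auto simp: profiles_1 rankings_facts card_image[OF inj_lone_voter])
qed

lemma scf_dist_1:
  "scf_dist 1 k f g =
     card {s \<in> rankings k. f (lone_voter s) \<noteq> g (lone_voter s)} / fact k"
proof -
  have "set_pmf (uniform_profile 1 k) = profiles 1 k"
    unfolding uniform_profile_def by (intro set_pmf_of_set) (auto simp: profiles_1 rankings_facts)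
  \<comment> \<open>The event in \<open>scf_dist\<close> also contains functions that are not
    profiles; these have probability zero.\<close>
  then have "scf_dist 1 k f g =
      measure_pmf.prob (uniform_profile 1 k) {\<sigma> \<in> profiles 1 k. f \<sigma> \<noteq> g \<sigma>}"
    unfolding scf_dist_def by (intro measure_pmf.finite_measure_eq_AE) (auto simp: AE_measure_pmf_iff)
  then show ?thesis by (simp only: prob_uniform_profile_1)
qed

text \<open>Makes the \<open>Min\<close> in \<open>scf_dist_set\<close> a lower bound for the
  distance to each member.\<close>

lemma finite_NONMANIP_1: "finite (NONMANIP 1 k)"
proof (rule finite_subset)
  show "NONMANIP 1 k \<subseteq> scfs 1 k" by (auto simp: NONMANIP_def)
  show "finite (scfs 1 k)"
    unfolding scfs_def by (intro finite_PiE) (auto simp: profiles_1 rankings_facts)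
qed

text \<open>Supplies the functions to which the distance assumption on \<open>f\<close> is applied;
  the restriction to \<open>profiles 1 k\<close> provides extensionality.\<close>

lemma top_of_in_NONMANIP:
  assumes "H \<noteq> {}" "H \<subseteq> {1..k}"
  shows "(\<lambda>\<sigma>\<in>profiles 1 k. top_of H (\<sigma> 1)) \<in> NONMANIP 1 k"
proof -
  have "top_of H s \<in> {1..k}" if "s \<in> rankings k" for s
    using top_of_mem[of s H] that assms by (auto simp: rankings_def permutations_of_set_def)
  then have "(\<lambda>\<sigma>\<in>profiles 1 k. top_of H (\<sigma> 1)) \<in> scfs 1 k"
    by (auto simp: scfs_def profiles_1)
  then show ?thesis using assms unfolding NONMANIP_def by auto
qed

theorem theorem1p4:
  fixes k :: nat and \<epsilon> :: real and f :: "profile \<Rightarrow> nat"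
  assumes "k \<ge> 3"
    and "\<epsilon> > 0"
    and "f \<in> scfs 1 k"
    and "scf_dist_set 1 k f (NONMANIP 1 k) \<ge> \<epsilon>"
  shows "measure_pmf.prob (uniform_profile 1 k) (manipulation_points 1 k f)
           \<ge> measure_pmf.prob (uniform_profile 1 k) (r_manipulation_points 3 1 k f) \<and>
         measure_pmf.prob (uniform_profile 1 k) (r_manipulation_points 3 1 k f)
           \<ge> \<epsilon> ^ 3 / (10 ^ 5 * real k ^ 16)"
proof
  show "measure_pmf.prob (uniform_profile 1 k) (r_manipulation_points 3 1 k f)
      \<le> measure_pmf.prob (uniform_profile 1 k) (manipulation_points 1 k f)"
    by (rule measure_pmf.finite_measure_mono)
      (auto simp: r_manipulation_points_def manipulation_points_def)
next
  define F where "F = (\<lambda>s. f (lone_voter s))"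
  have F: "F ` permutations_of_set {1..k} \<subseteq> {1..k}"
  proof clarify
    fix s assume "s \<in> permutations_of_set {1..k}"
    then have "lone_voter s \<in> profiles 1 k" by (simp add: profiles_1 rankings_def)
    then show "F s \<in> {1..k}" using assms(3) unfolding F_def scfs_def by (rule PiE_mem[rotated])
  qed
  have far: "\<epsilon> \<le> card {s \<in> rankings k. F s \<noteq> top_of H s} / fact k"
    if "H \<noteq> {}" "H \<subseteq> {1..k}" for H
  proof -
    let ?g = "\<lambda>\<sigma>\<in>profiles 1 k. top_of H (\<sigma> 1)"
    have "\<epsilon> \<le> scf_dist 1 k f ?g"
      using assms(4) finite_NONMANIP_1 top_of_in_NONMANIP[OF that]
      unfolding scf_dist_set_def by (auto intro: order_trans[OF _ Min_le])
    also have "{s \<in> rankings k. f (lone_voter s) \<noteq> ?g (lone_voter s)} =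
        {s \<in> rankings k. F s \<noteq> top_of H s}"
      by (auto simp: F_def profiles_1)
    then have "scf_dist 1 k f ?g = card {s \<in> rankings k. F s \<noteq> top_of H s} / fact k"
      by (simp only: scf_dist_1)
    finally show ?thesis .
  qed
  \<comment> \<open>A distance is a proportion of rankings, so \<epsilon> \<le> 1; any nonempty
    \<open>H\<close> would serve here.\<close>
  have "card {s \<in> rankings k. F s \<noteq> top_of {1..k} s} \<le> card (rankings k)"
    by (intro card_mono) (auto simp: rankings_facts)
  then have "real (card {s \<in> rankings k. F s \<noteq> top_of {1..k} s}) \<le> fact k"
    by (metis of_nat_le_iff of_nat_fact rankings_facts(3))
  then have \<epsilon>1: "\<epsilon> \<le> 1"
    using far[of "{1..k}"] assms(1) by (auto intro: order_trans simp: divide_le_eq_1)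
  have "\<epsilon>\<^sup>2 / (4 * real k ^ 5) * fact k \<le> card (local_manips {1..k} F)"
  proof -
    have "\<epsilon> * fact k \<le> card {s \<in> permutations_of_set {1..k}. F s \<noteq> top_of H s}"
      if "H \<noteq> {}" "H \<subseteq> {1..k}" for H
      using far[OF that] by (simp add: rankings_def pos_le_divide_eq)
    then show ?thesis
      using local_manips_lower_bound[OF F _ _ assms(2) \<epsilon>1] assms(1) by simp
  qed
  \<comment> \<open>For a single voter \<open>differ_only_at\<close> is vacuous, so only the block
    condition ties the new ranking to the old one.\<close>
  moreover have "r_manipulation_points 3 1 k f =
      {\<sigma> \<in> profiles 1 k. \<sigma> 1 \<in> local_manips {1..k} F}"
    by (auto simp: r_manipulation_points_def local_manips_def profiles_1 differ_only_at_def
        F_def rankings_def)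
  moreover have "{s \<in> rankings k. lone_voter s 1 \<in> local_manips {1..k} F} = local_manips {1..k} F"
    by (auto simp: local_manips_def rankings_def)
  ultimately have "\<epsilon>\<^sup>2 / (4 * real k ^ 5) \<le>
      measure_pmf.prob (uniform_profile 1 k) (r_manipulation_points 3 1 k f)"
    by (simp only: prob_uniform_profile_1) (simp add: pos_le_divide_eq)
  \<comment> \<open>The bound obtained is stronger than the claim: \<epsilon>^3 \<le> \<epsilon>^2
    since \<epsilon> \<le> 1, and 4 k^5 \<le> 10^5 k^16.\<close>
  moreover have "\<epsilon> ^ 3 / (10 ^ 5 * real k ^ 16) \<le> \<epsilon>\<^sup>2 / (4 * real k ^ 5)"
    using assms(1,2) \<epsilon>1
    by (intro frac_le mult_mono power_decreasing power_increasing) auto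
  ultimately show "\<epsilon> ^ 3 / (10 ^ 5 * real k ^ 16) \<le>
      measure_pmf.prob (uniform_profile 1 k) (r_manipulation_points 3 1 k f)"
    by simp
qed

end
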